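(* Let $p\in\mathbb{N}$. Let $\{A_k\}_{k=1}^\infty\subset\mathcal{B}(\mathcal{H})$ be a sequence of diagonal operators, $A_k=\operatorname{diag}[a_k(n)]_{n=1}^\infty$, such that $a_k(pn)=a_k(n)$ for all $k,n\in\mathbb{N}$ (equivalently, $A_kM_p=M_pA_k$ for all $k$). Assume that for each $n\in\mathbb{N}$ the series $$\alpha_n(z)=1+\sum_{k=1}^\infty a_k(n)z^k$$ defines an analytic function on $\mathbb{D}$, that $$\sup_{z\in\mathbb{D},\,n\in\mathbb{N}}|\alpha_n(z)|<\infty,$$ and that the associated family of bounded operators $\mathbb{A}(z)=I+\sum_{k=1}^\infty A_kz^k=\operatorname{diag}[\alpha_n(z)]_{n=1}^\infty$, $z\in\mathbb{D}$, is analytic. Then the operator $$T=I+\sum_{k=1}^\infty A_kM_{p^k}$$ is invertible if and only if $$s(T)=\inf_{z\in\mathbb{D},\,n\in\mathbb{N}}|\alpha_n(z)|>0.$$ Moreover, $\|T^{-1}\|=\dfrac{1}{s(T)}$.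
   Context: $\mathcal{H}$ is a separable complex Hilbert space with a fixed orthonormal basis $\{e_n\}_{n=1}^\infty$, $\mathbb{N}=\{1,2,\ldots\}$ and $\mathbb{D}=\{z\in\mathbb{C}:|z|<1\}$. $\mathcal{B}(\mathcal{H})$ is the space of bounded linear operators on $\mathcal{H}$ and $\|\cdot\|$ is its operator norm. For $j\in\mathbb{N}$, $M_j:\mathcal{H}\to\mathcal{H}$ is the multiplicative (spread) shift, the linear operator with $M_je_n=e_{nj}$ for all $n\in\mathbb{N}$. For a bounded scalar sequence $\{a(n)\}_{n=1}^\infty\subset\mathbb{C}$, $\operatorname{diag}[a(n)]_{n=1}^\infty$ is the bounded operator on $\mathcal{H}$ with $e_n\mapsto a(n)e_n$.
   Formalization: p ≥ 2 is assumed, since the claim fails for p = 1: with a_1(n) = 1 and a_k = 0 for k ≥ 2, T = 2I is invertible although s(T) = inf|1+z| = 0; the series for T is read on basis vectors. *)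

theory Defs
  imports "HOL-Analysis.Analysis"
begin

class scaleC = scaleR +
  fixes scaleC :: "complex \<Rightarrow> 'a \<Rightarrow> 'a"  (infixr \<open>*\<^sub>C\<close> 75)
  assumes scaleR_scaleC: "scaleR r x = complex_of_real r *\<^sub>C x"

class complex_vector = scaleC + ab_group_add +
  assumes scaleC_add_right: "c *\<^sub>C (x + y) = c *\<^sub>C x + c *\<^sub>C y"
    and scaleC_add_left: "(c + d) *\<^sub>C x = c *\<^sub>C x + d *\<^sub>C x"
    and scaleC_scaleC: "c *\<^sub>C d *\<^sub>C x = (c * d) *\<^sub>C x"
    and scaleC_one: "1 *\<^sub>C x = x"

class complex_normed_vector = complex_vector + real_normed_vector +
  assumes norm_scaleC: "norm (c *\<^sub>C x) = cmod c * norm x"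

text \<open>The inner product is linear in its first argument. Positive definiteness is contained in
  the last axiom, because the norm of a \<^class>\<open>real_normed_vector\<close> is positive definite.\<close>

class complex_inner = complex_normed_vector +
  fixes cinner :: "'a \<Rightarrow> 'a \<Rightarrow> complex"
  assumes cinner_commute: "cinner x y = cnj (cinner y x)"
    and cinner_add_left: "cinner (x + y) z = cinner x z + cinner y z"
    and cinner_scaleC_left: "cinner (c *\<^sub>C x) y = c * cinner x y"
    and cinner_self: "cinner x x = complex_of_real ((norm x)\<^sup>2)"

class complex_hilbert = complex_inner + banach

lemma bounded_linear_scaleC_right:
  "bounded_linear (\<lambda>x. c *\<^sub>C (x :: 'a :: complex_normed_vector))"
proof (rule bounded_linear_intro)
  show "c *\<^sub>C (x + y) = c *\<^sub>C x + c *\<^sub>C y" for x y :: 'a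
    by (rule scaleC_add_right)
  show "c *\<^sub>C r *\<^sub>R x = r *\<^sub>R c *\<^sub>C x" for r and x :: 'a
    by (simp add: scaleR_scaleC scaleC_scaleC mult.commute)
  show "norm (c *\<^sub>C x) \<le> norm x * cmod c" for x :: 'a
    by (simp add: norm_scaleC mult.commute)
qed

text \<open>The type \<open>'a \<Rightarrow>\<^sub>L 'b\<close> consists of the bounded \<^emph>\<open>real\<close>-linear maps with the
  operator norm. Over a complex space \<open>'b\<close> it is itself a complex normed space; the bounded operators
  in the complex sense are its members satisfying \<open>complex_linear\<close> below.\<close>

instantiation blinfun :: (real_normed_vector, complex_normed_vector) complex_normed_vector
begin

lift_definition scaleC_blinfun :: "complex \<Rightarrow> 'a \<Rightarrow>\<^sub>L 'b \<Rightarrow> 'a \<Rightarrow>\<^sub>L 'b"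
  is "\<lambda>c f x. c *\<^sub>C f x"
  by (rule bounded_linear_compose[OF bounded_linear_scaleC_right])

instance
proof
  fix c d :: complex and r :: real and f g :: "'a \<Rightarrow>\<^sub>L 'b"
  show "r *\<^sub>R f = complex_of_real r *\<^sub>C f"
    by transfer (simp add: scaleR_scaleC)
  show "c *\<^sub>C (f + g) = c *\<^sub>C f + c *\<^sub>C g"
    by transfer (simp add: scaleC_add_right)
  show "(c + d) *\<^sub>C f = c *\<^sub>C f + d *\<^sub>C f"
    by transfer (simp add: scaleC_add_left)
  show "c *\<^sub>C d *\<^sub>C f = (c * d) *\<^sub>C f"
    by transfer (simp add: scaleC_scaleC)
  show "1 *\<^sub>C f = f"
    by transfer (simp add: scaleC_one)
  show "norm (c *\<^sub>C f) = cmod c * norm f"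
  proof transfer
    fix c :: complex and f :: "'a \<Rightarrow> 'b"
    assume "bounded_linear f"
    then have "onorm (\<lambda>x. cmod c *\<^sub>R f x) = \<bar>cmod c\<bar> * onorm f"
      by (rule onorm_scaleR)
    then show "onorm (\<lambda>x. c *\<^sub>C f x) = cmod c * onorm f"
      by (simp add: onorm_def norm_scaleC)
  qed
qed

end

definition complex_linear ::
    "('a :: complex_normed_vector \<Rightarrow>\<^sub>L 'b :: complex_normed_vector) \<Rightarrow> bool" where
  "complex_linear T \<longleftrightarrow> (\<forall>c x. blinfun_apply T (c *\<^sub>C x) = c *\<^sub>C blinfun_apply T x)"

text \<open>Bases are indexed by the positive integers; the value \<open>e 0\<close> is never used. The span is the
  complex one.\<close>

definition orthonormal_basis :: "(nat \<Rightarrow> 'a :: complex_hilbert) \<Rightarrow> bool" where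
  "orthonormal_basis e \<longleftrightarrow>
     (\<forall>m\<ge>1. \<forall>n\<ge>1. cinner (e m) (e n) = (if m = n then 1 else 0)) \<and>
     closure (module.span scaleC (e ` {1..})) = UNIV"

definition is_diag ::
    "(nat \<Rightarrow> 'a :: complex_hilbert) \<Rightarrow> (nat \<Rightarrow> complex) \<Rightarrow> ('a \<Rightarrow>\<^sub>L 'a) \<Rightarrow> bool" where
  "is_diag e a D \<longleftrightarrow> complex_linear D \<and> (\<forall>n\<ge>1. blinfun_apply D (e n) = a n *\<^sub>C e n)"

definition is_spread_shift ::
    "(nat \<Rightarrow> 'a :: complex_hilbert) \<Rightarrow> nat \<Rightarrow> ('a \<Rightarrow>\<^sub>L 'a) \<Rightarrow> bool" where
  "is_spread_shift e j M \<longleftrightarrow> complex_linear M \<and> (\<forall>n\<ge>1. blinfun_apply M (e n) = e (n * j))"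

text \<open>For an open set \<open>S\<close>. For operator-valued \<open>F\<close> the limit is in operator norm, and a limit of
  complex-linear operators is complex linear.\<close>

definition vector_analytic_on :: "(complex \<Rightarrow> 'b :: complex_normed_vector) \<Rightarrow> complex set \<Rightarrow> bool"
  where
  "vector_analytic_on F S \<longleftrightarrow>
     (\<forall>z\<in>S. \<exists>D. ((\<lambda>h. inverse h *\<^sub>C (F (z + h) - F z)) \<longlongrightarrow> D) (at 0))"

definition alpha :: "(nat \<Rightarrow> nat \<Rightarrow> complex) \<Rightarrow> nat \<Rightarrow> complex \<Rightarrow> complex" where
  "alpha a n z = 1 + (\<Sum>k. a (Suc k) n * z ^ Suc k)"

text \<open>\<open>T = I + (\<Sum>k\<ge>1. A k M\<^bsub>p^k\<^esub>)\<close>, meaning that \<open>T\<close> is the bounded operator given by this series on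
  every basis vector. Convergence of the series in the norm, strong or weak operator topology cannot
  be required: for \<open>p \<ge> 2\<close> it is the Taylor series of a direct sum of analytic Toeplitz operators,
  and the Taylor polynomials of a bounded analytic function need not be uniformly bounded.\<close>

definition is_series_operator ::
    "(nat \<Rightarrow> 'a :: complex_hilbert) \<Rightarrow> nat \<Rightarrow> (nat \<Rightarrow> 'a \<Rightarrow>\<^sub>L 'a) \<Rightarrow> (nat \<Rightarrow> 'a \<Rightarrow>\<^sub>L 'a)
       \<Rightarrow> ('a \<Rightarrow>\<^sub>L 'a) \<Rightarrow> bool" where
  "is_series_operator e p A M T \<longleftrightarrow> complex_linear T \<and>
     (\<forall>n\<ge>1. (\<lambda>k. blinfun_apply (A (Suc k) o\<^sub>L M (p ^ Suc k)) (e n))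
        sums (blinfun_apply T (e n) - e n))"

definition lower_bound :: "(nat \<Rightarrow> nat \<Rightarrow> complex) \<Rightarrow> real" where
  "lower_bound a = (INF (z, n) \<in> ball 0 1 \<times> {1..}. cmod (alpha a n z))"

definition is_inverse_op ::
    "('a :: complex_normed_vector \<Rightarrow>\<^sub>L 'a) \<Rightarrow> ('a \<Rightarrow>\<^sub>L 'a) \<Rightarrow> bool" where
  "is_inverse_op T S \<longleftrightarrow> complex_linear S \<and> T o\<^sub>L S = id_blinfun \<and> S o\<^sub>L T = id_blinfun"

definition invertible_op :: "('a :: complex_normed_vector \<Rightarrow>\<^sub>L 'a) \<Rightarrow> bool" where
  "invertible_op T \<longleftrightarrow> (\<exists>S. is_inverse_op T S)"

definition inverse_op :: "('a :: complex_normed_vector \<Rightarrow>\<^sub>L 'a) \<Rightarrow> 'a \<Rightarrow>\<^sub>L 'a" where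
  "inverse_op T = (THE S. is_inverse_op T S)"

end

theory Submission
  imports Defs "HOL-Complex_Analysis.Complex_Analysis"
begin

text \<open>Every \<open>n \<ge> 1\<close> is uniquely \<open>m p^j\<close> with \<open>p\<close> not dividing \<open>m\<close>. On the closed span of the chain
  \<open>e (m p^j)\<close>, \<open>j \<ge> 0\<close>, the operator \<open>T\<close> is the Toeplitz operator with analytic symbol
  \<open>\<alpha>\<^sub>m\<close>, that is, multiplication by the power series \<open>\<alpha>\<^sub>m\<close> on square summable coefficient
  sequences. Its norm is at most the supremum of the symbol: apply Parseval's identity over roots of
  unity to Taylor polynomials on circles of radius \<open>r < 1\<close> and let \<open>r\<close> tend to \<open>1\<close>. Applied to the
  symbols \<open>1 / \<alpha>\<^sub>m\<close>, this yields an inverse of norm at most \<open>1 / s(T)\<close>. Conversely, the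
  adjoint of \<open>T\<close> has eigenvectors with eigenvalues \<open>cnj (\<alpha>\<^sub>m(z))\<close>, \<open>z\<close> in the disc, so any inverse has
  norm at least \<open>1 / \<bar>\<alpha>\<^sub>m(z)\<bar>\<close>.\<close>

subsection \<open>Complex inner product spaces\<close>

lemma cinner_add_right: "cinner x (y + z) = cinner x y + cinner (x :: 'a :: complex_inner) z"
  by (metis cinner_add_left cinner_commute complex_cnj_add)

lemma cinner_scaleC_right: "cinner x (c *\<^sub>C y) = cnj c * cinner (x :: 'a :: complex_inner) y"
  by (metis cinner_scaleC_left cinner_commute complex_cnj_mult)

lemma cinner_scaleR_left: "cinner (r *\<^sub>R x) y = r *\<^sub>R cinner (x :: 'a :: complex_inner) y"
  by (simp add: scaleR_scaleC cinner_scaleC_left scaleR_conv_of_real)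

lemma cinner_scaleR_right: "cinner x (r *\<^sub>R y) = r *\<^sub>R cinner (x :: 'a :: complex_inner) y"
  by (simp add: scaleR_scaleC cinner_scaleC_right scaleR_conv_of_real)

lemma cinner_zero_left [simp]: "cinner 0 (y :: 'a :: complex_inner) = 0"
  using cinner_add_left[of 0 0 y] by simp

lemma cinner_zero_right [simp]: "cinner (x :: 'a :: complex_inner) 0 = 0"
  using cinner_add_right[of x 0 0] by simp

lemma cinner_minus_left: "cinner (- x) y = - cinner (x :: 'a :: complex_inner) y"
  using cinner_scaleR_left[of "-1" x y] by simp

lemma cinner_minus_right: "cinner x (- y) = - cinner (x :: 'a :: complex_inner) y"
  using cinner_scaleR_right[of x "-1" y] by simp

lemma cinner_diff_left: "cinner (x - y) z = cinner x z - cinner (y :: 'a :: complex_inner) z"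
  using cinner_add_left[of x "- y" z] by (simp add: cinner_minus_left)

lemma cinner_diff_right: "cinner x (y - z) = cinner x y - cinner (x :: 'a :: complex_inner) z"
  using cinner_add_right[of x y "- z"] by (simp add: cinner_minus_right)

lemma cinner_sum_left: "cinner (\<Sum>i\<in>I. f i) y = (\<Sum>i\<in>I. cinner (f i :: 'a :: complex_inner) y)"
  by (induction I rule: infinite_finite_induct) (simp_all add: cinner_add_left)

lemma cinner_sum_right: "cinner x (\<Sum>i\<in>I. f i) = (\<Sum>i\<in>I. cinner x (f i :: 'a :: complex_inner))"
  by (induction I rule: infinite_finite_induct) (simp_all add: cinner_add_right)

lemma cinner_mult_cinner_commute: "cinner x y * cinner y x = complex_of_real ((cmod (cinner x y))\<^sup>2)"
  by (metis cinner_commute complex_norm_square)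

text \<open>The component of \<open>x\<close> orthogonal to \<open>y\<close> has squared norm |x|^2
  - |<x,y>|^2 / |y|^2, which cannot be negative.\<close>

lemma cinner_Cauchy_Schwarz:
  fixes x y :: "'a :: complex_inner"
  shows "cmod (cinner x y) \<le> norm x * norm y"
proof (cases "y = 0")
  case False
  define c where "c = cinner x y / complex_of_real ((norm y)\<^sup>2)"
  have "complex_of_real ((norm (x - c *\<^sub>C y))\<^sup>2) = cinner (x - c *\<^sub>C y) (x - c *\<^sub>C y)"
    by (simp add: cinner_self)
  also have "\<dots> = cinner x x - cnj c * cinner x y - c * cinner y x + c * cnj c * cinner y y"
    by (simp add: cinner_diff_left cinner_diff_right cinner_scaleC_left cinner_scaleC_right
        algebra_simps)
  also have "cnj c = cinner y x / complex_of_real ((norm y)\<^sup>2)"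
    unfolding c_def by (simp flip: cinner_commute)
  also have "cinner x x - cinner y x / complex_of_real ((norm y)\<^sup>2) * cinner x y - c * cinner y x
      + c * (cinner y x / complex_of_real ((norm y)\<^sup>2)) * cinner y y
      = cinner x x - cinner x y * cinner y x / complex_of_real ((norm y)\<^sup>2)"
    using False by (simp add: c_def cinner_self field_simps)
  also have "\<dots> = complex_of_real ((norm x)\<^sup>2 - (cmod (cinner x y))\<^sup>2 / (norm y)\<^sup>2)"
    by (simp add: cinner_self cinner_mult_cinner_commute)
  finally have "(norm (x - c *\<^sub>C y))\<^sup>2 = (norm x)\<^sup>2 - (cmod (cinner x y))\<^sup>2 / (norm y)\<^sup>2"
    using of_real_eq_iff by blast
  then have "(cmod (cinner x y))\<^sup>2 / (norm y)\<^sup>2 \<le> (norm x)\<^sup>2"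
    by (metis diff_ge_0_iff_ge zero_le_power2)
  then have "(cmod (cinner x y))\<^sup>2 \<le> (norm x * norm y)\<^sup>2"
    using False by (simp add: divide_le_eq power_mult_distrib)
  then show ?thesis
    by (rule power2_le_imp_le) simp
qed simp

lemma bounded_linear_cinner_left: "bounded_linear (\<lambda>x. cinner x (y :: 'a :: complex_inner))"
  by (rule bounded_linear_intro[where K = "norm y"])
    (simp_all add: cinner_add_left cinner_scaleR_left cinner_Cauchy_Schwarz)

lemma bounded_linear_cinner_right: "bounded_linear (cinner (x :: 'a :: complex_inner))"
  by (rule bounded_linear_intro[where K = "norm x"])
    (simp_all add: cinner_add_right cinner_scaleR_right cinner_Cauchy_Schwarz
      mult.commute[of _ "norm x"])

section \<open>Orthonormal families\<close>

definition orthonormal :: "('i \<Rightarrow> 'a :: complex_inner) \<Rightarrow> 'i set \<Rightarrow> bool" where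
  "orthonormal f I \<longleftrightarrow> (\<forall>i\<in>I. \<forall>j\<in>I. cinner (f i) (f j) = (if i = j then 1 else 0))"

lemma orthonormal_subset: "orthonormal f I \<Longrightarrow> J \<subseteq> I \<Longrightarrow> orthonormal f J"
  unfolding orthonormal_def by blast

lemma orthonormal_compose:
  "orthonormal f I \<Longrightarrow> inj_on g J \<Longrightarrow> g ` J \<subseteq> I \<Longrightarrow> orthonormal (\<lambda>j. f (g j)) J"
  unfolding orthonormal_def by (auto simp: inj_on_eq_iff image_subset_iff)

lemma cinner_orthonormal_sum:
  assumes "orthonormal f I" "finite I" "i \<in> I"
  shows "cinner (\<Sum>j\<in>I. c j *\<^sub>C f j) (f i) = c i"
proof -
  have "cinner (\<Sum>j\<in>I. c j *\<^sub>C f j) (f i) = (\<Sum>j\<in>I. if j = i then c j else 0)"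
    unfolding cinner_sum_left
    using assms by (intro sum.cong) (auto simp: cinner_scaleC_left orthonormal_def)
  then show ?thesis
    using assms by simp
qed

lemma norm_orthonormal_sum:
  assumes "orthonormal f I" "finite I"
  shows "(norm (\<Sum>i\<in>I. c i *\<^sub>C f i))\<^sup>2 = (\<Sum>i\<in>I. (cmod (c i))\<^sup>2)"
proof -
  have "complex_of_real ((norm (\<Sum>i\<in>I. c i *\<^sub>C f i))\<^sup>2) =
      (\<Sum>i\<in>I. cnj (c i) * cinner (\<Sum>j\<in>I. c j *\<^sub>C f j) (f i))"
    unfolding cinner_self[symmetric] by (subst cinner_sum_right) (simp add: cinner_scaleC_right)
  also have "\<dots> = (\<Sum>i\<in>I. cnj (c i) * c i)"
    by (intro sum.cong refl) (simp add: cinner_orthonormal_sum[OF assms])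
  also have "\<dots> = complex_of_real (\<Sum>i\<in>I. (cmod (c i))\<^sup>2)"
    by (simp add: mult.commute flip: complex_norm_square)
  finally show ?thesis
    using of_real_eq_iff by blast
qed

text \<open>The projection \<open>s\<close> of \<open>x\<close> onto the span satisfies <x,s> =
  |s|^2, so Cauchy-Schwarz gives |s| \<le> |x|.\<close>

lemma Bessel_inequality:
  assumes "orthonormal f I" "finite I"
  shows "(\<Sum>i\<in>I. (cmod (cinner x (f i)))\<^sup>2) \<le> (norm x)\<^sup>2"
proof -
  define s where "s = (\<Sum>i\<in>I. cinner x (f i) *\<^sub>C f i)"
  have "cinner x s = (\<Sum>i\<in>I. cnj (cinner x (f i)) * cinner x (f i))"
    unfolding s_def by (simp add: cinner_sum_right cinner_scaleC_right)
  also have "\<dots> = complex_of_real ((norm s)\<^sup>2)"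
    unfolding s_def norm_orthonormal_sum[OF assms]
    by (simp add: mult.commute flip: complex_norm_square)
  finally have "(norm s)\<^sup>2 = cmod (cinner x s)"
    by (simp add: norm_power)
  also have "\<dots> \<le> norm x * norm s"
    by (rule cinner_Cauchy_Schwarz)
  finally have "norm s \<le> norm x"
    by (cases "norm s = 0") (simp_all add: power2_eq_square)
  then have "(norm s)\<^sup>2 \<le> (norm x)\<^sup>2"
    by simp
  then show ?thesis
    unfolding s_def norm_orthonormal_sum[OF assms] .
qed

text \<open>By Pythagoras, the squared norm of a block of the vector series is the same block of the
  scalar series. The partial sums are therefore Cauchy, and completeness gives the limit.\<close>

lemma Riesz_Fischer:
  fixes f :: "nat \<Rightarrow> 'a :: complex_hilbert"
  assumes "orthonormal f UNIV" "summable (\<lambda>k. (cmod (c k))\<^sup>2)"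
  shows "summable (\<lambda>k. c k *\<^sub>C f k)"
  unfolding summable_Cauchy
proof (intro allI impI)
  fix \<epsilon> :: real
  assume "\<epsilon> > 0"
  then have "\<epsilon>\<^sup>2 > 0"
    by simp
  then obtain N where N: "\<And>m n. m \<ge> N \<Longrightarrow> norm (\<Sum>k\<in>{m..<n}. (cmod (c k))\<^sup>2) < \<epsilon>\<^sup>2"
    using assms(2) unfolding summable_Cauchy by blast
  have "norm (\<Sum>k\<in>{m..<n}. c k *\<^sub>C f k) < \<epsilon>" if "m \<ge> N" for m n
  proof -
    have "(norm (\<Sum>k\<in>{m..<n}. c k *\<^sub>C f k))\<^sup>2 = (\<Sum>k\<in>{m..<n}. (cmod (c k))\<^sup>2)"
      by (intro norm_orthonormal_sum orthonormal_subset[OF assms(1)]) auto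
    also have "\<dots> < \<epsilon>\<^sup>2"
      using N[OF that, of n] by (simp add: sum_nonneg)
    finally show ?thesis
      using \<open>\<epsilon> > 0\<close> by (intro power2_less_imp_less[of _ \<epsilon>]) auto
  qed
  then show "\<exists>N. \<forall>m\<ge>N. \<forall>n. norm (\<Sum>k\<in>{m..<n}. c k *\<^sub>C f k) < \<epsilon>"
    by blast
qed

lemma cinner_orthonormal_suminf:
  assumes "orthonormal f UNIV" "summable (\<lambda>k. c k *\<^sub>C f k)"
  shows "cinner (\<Sum>k. c k *\<^sub>C f k) (f n) = c n"
proof -
  have "(\<lambda>k. cinner (c k *\<^sub>C f k) (f n)) sums cinner (\<Sum>k. c k *\<^sub>C f k) (f n)"
    using bounded_linear.sums[OF bounded_linear_cinner_left summable_sums[OF assms(2)]] .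
  moreover have "(\<lambda>k. cinner (c k *\<^sub>C f k) (f n)) = (\<lambda>k. if k = n then c k else 0)"
    using assms(1) by (auto simp: cinner_scaleC_left orthonormal_def)
  ultimately have "(\<lambda>k. if k = n then c k else 0) sums cinner (\<Sum>k. c k *\<^sub>C f k) (f n)"
    by simp
  then show ?thesis
    using sums_single[of n c] by (rule sums_unique2)
qed

section \<open>Orthonormal bases\<close>

lemma orthonormal_basis_orthonormal: "orthonormal_basis e \<Longrightarrow> orthonormal e {1..}"
  unfolding orthonormal_basis_def orthonormal_def by simp

text \<open>Induction principle for bases: a condition that cuts out a closed subspace need only be
  checked on basis vectors.\<close>

lemma orthonormal_basis_closed_subspace:
  fixes e :: "nat \<Rightarrow> 'a :: complex_hilbert"
  assumes "orthonormal_basis e" "closed S" "0 \<in> S"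
    and "\<And>x y. x \<in> S \<Longrightarrow> y \<in> S \<Longrightarrow> x + y \<in> S" "\<And>c x. x \<in> S \<Longrightarrow> c *\<^sub>C x \<in> S"
    and "\<And>n. n \<ge> 1 \<Longrightarrow> e n \<in> S"
  shows "S = UNIV"
proof -
  interpret module "scaleC :: complex \<Rightarrow> 'a \<Rightarrow> 'a"
    by unfold_locales (simp_all add: scaleC_add_right scaleC_add_left scaleC_scaleC scaleC_one)
  have "subspace S"
    using assms(3-5) unfolding subspace_def by blast
  then have "span (e ` {1..}) \<subseteq> S"
    using assms(6) by (intro span_minimal) auto
  then have "closure (span (e ` {1..})) \<subseteq> S"
    using assms(2) by (rule closure_minimal)
  then show ?thesis
    using assms(1) unfolding orthonormal_basis_def by auto
qed

text \<open>The vectors orthogonal to \<open>x - y\<close> form a closed subspace containing the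
  basis, hence containing \<open>x - y\<close> itself.\<close>

lemma orthonormal_basis_eqI:
  fixes e :: "nat \<Rightarrow> 'a :: complex_hilbert"
  assumes "orthonormal_basis e" "\<And>n. n \<ge> 1 \<Longrightarrow> cinner x (e n) = cinner y (e n)"
  shows "x = y"
proof -
  have "{u. cinner (x - y) u = 0} = UNIV"
    using assms(2)
    by (intro orthonormal_basis_closed_subspace[OF assms(1)])
      (auto simp: cinner_add_right cinner_scaleC_right cinner_diff_left
        intro!: closed_Collect_eq continuous_intros
          linear_continuous_on[OF bounded_linear_cinner_right])
  then have "cinner (x - y) (x - y) = 0"
    by blast
  then show ?thesis
    by (simp add: cinner_self)
qed

lemma complex_linear_eqI:
  fixes e :: "nat \<Rightarrow> 'a :: complex_hilbert"
  assumes "orthonormal_basis e" "complex_linear S" "complex_linear T"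
    and "\<And>n. n \<ge> 1 \<Longrightarrow> blinfun_apply S (e n) = blinfun_apply T (e n)"
  shows "S = T"
proof -
  have "{u. blinfun_apply S u = blinfun_apply T u} = UNIV"
    using assms(2-4)
    by (intro orthonormal_basis_closed_subspace[OF assms(1)])
      (auto simp: complex_linear_def blinfun.add_right blinfun.zero_right
        intro!: closed_Collect_eq continuous_intros)
  then show ?thesis
    by (intro blinfun_eqI) blast
qed

subsection \<open>Multiplication by a bounded analytic function on square summable sequences\<close>

lemma sum_roots_of_unity:
  fixes N :: nat and d :: int
  assumes "N > 0" "\<not> int N dvd d"
  shows "(\<Sum>j<N. cis (2 * pi * real j / real N * real_of_int d)) = 0"
proof -
  \<comment> \<open>The sum is geometric with ratio \<open>w\<close>, an \<open>N\<close>-th root of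
    unity other than 1, so it equals (w^N - 1) / (w - 1) = 0.\<close>
  define w where "w = cis (2 * pi * real_of_int d / real N)"
  have w: "w \<noteq> 1"
  proof
    assume "w = 1"
    then have "cos (2 * pi * real_of_int d / real N) = 1"
      by (metis w_def cis.simps(1) one_complex.simps(1))
    then obtain n :: int where "2 * pi * real_of_int d / real N = real_of_int n * 2 * pi"
      by (auto simp: cos_one_2pi_int)
    then have "real_of_int d = real_of_int (n * int N)"
      using assms(1) by (simp add: field_simps)
    then have "d = n * int N"
      using of_int_eq_iff by blast
    then show False
      using assms(2) by simp
  qed
  have "w ^ N = cis (2 * pi * real_of_int d)"
    using assms(1) unfolding w_def Complex.DeMoivre by simp
  also have "\<dots> = 1"
    by (rule cis_multiple_2pi) simp
  finally have "w ^ N = 1" .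
  moreover have "cis (2 * pi * real j / real N * real_of_int d) = w ^ j" for j
    unfolding w_def Complex.DeMoivre by (simp add: mult_ac)
  ultimately show ?thesis
    using w by (simp add: geometric_sum)
qed

text \<open>Expanding the squares and summing over \<open>j\<close> first leaves only the diagonal
  terms, because distinct exponents below \<open>N\<close> never differ by a multiple of
  \<open>N\<close>.\<close>

lemma Parseval_roots_of_unity:
  fixes c :: "nat \<Rightarrow> complex"
  shows "(\<Sum>j<N. (cmod (\<Sum>k<N. c k * cis (2 * pi * real j / real N) ^ k))\<^sup>2)
    = real N * (\<Sum>k<N. (cmod (c k))\<^sup>2)"
proof -
  let ?w = "\<lambda>j. cis (2 * pi * real j / real N)"
  have ww: "?w j ^ k * cnj (?w j ^ l) = cis (2 * pi * real j / real N * real_of_int (int k - int l))"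
    for j k l
    unfolding complex_cnj_power cis_cnj Complex.DeMoivre cis_mult
    by (rule arg_cong[where f = cis]) (simp add: algebra_simps diff_divide_distrib)
  have orth: "(\<Sum>j<N. ?w j ^ k * cnj (?w j ^ l)) = (if k = l then of_nat N else 0)"
    if "k < N" "l < N" for k l
  proof (cases "k = l")
    case False
    have "\<not> int N dvd int k - int l"
      using that False zdvd_not_zless[of "\<bar>int k - int l\<bar>" "int N"] by (auto simp: dvd_abs_iff)
    then show ?thesis
      using False that sum_roots_of_unity[of N "int k - int l"] unfolding ww by simp
  qed (simp add: ww del: complex_cnj_power)
  have "complex_of_real (\<Sum>j<N. (cmod (\<Sum>k<N. c k * ?w j ^ k))\<^sup>2)
      = (\<Sum>j<N. (\<Sum>k<N. c k * ?w j ^ k) * cnj (\<Sum>l<N. c l * ?w j ^ l))"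
    by (simp only: of_real_sum complex_norm_square)
  also have "\<dots> = (\<Sum>j<N. \<Sum>k<N. \<Sum>l<N. c k * cnj (c l) * (?w j ^ k * cnj (?w j ^ l)))"
    by (simp add: sum_product mult_ac)
  also have "\<dots> = (\<Sum>k<N. \<Sum>l<N. \<Sum>j<N. c k * cnj (c l) * (?w j ^ k * cnj (?w j ^ l)))"
    by (rule trans[OF sum.swap]) (intro sum.cong refl sum.swap)
  also have "\<dots> = (\<Sum>k<N. \<Sum>l<N. if k = l then c k * cnj (c l) * of_nat N else 0)"
    unfolding sum_distrib_left[symmetric] by (intro sum.cong refl) (auto simp: orth simp del: complex_cnj_power)
  also have "\<dots> = (\<Sum>k<N. of_nat N * (c k * cnj (c k)))"
    by (intro sum.cong refl) (simp add: mult.commute)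
  also have "\<dots> = complex_of_real (real N * (\<Sum>k<N. (cmod (c k))\<^sup>2))"
    by (simp add: sum_distrib_left flip: complex_norm_square)
  finally show ?thesis
    using of_real_eq_iff by blast
qed

section \<open>Convolution estimates, for polynomials and then for power series\<close>

lemma poly_eq_sum_lessThan:
  fixes P :: "'a :: comm_semiring_1 poly"
  assumes "degree P < L"
  shows "poly P z = (\<Sum>k<L. coeff P k * z ^ k)"
proof -
  have "poly P z = (\<Sum>k\<le>degree P. coeff P k * z ^ k)"
    by (rule poly_altdef)
  also have "\<dots> = (\<Sum>k<L. coeff P k * z ^ k)"
    using assms by (intro sum.mono_neutral_left) (auto simp: coeff_eq_0)
  finally show ?thesis .
qed

lemma Parseval_poly:
  fixes P :: "complex poly"
  assumes "degree P < L"
  shows "(\<Sum>j<L. (cmod (poly P (of_real r * cis (2 * pi * real j / real L))))\<^sup>2)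
    = real L * (\<Sum>k<L. (cmod (coeff P k * of_real r ^ k))\<^sup>2)"
  using Parseval_roots_of_unity[of "\<lambda>k. coeff P k * of_real r ^ k" L]
  by (simp add: poly_eq_sum_lessThan[OF assms] power_mult_distrib mult_ac)

lemma coeff_sum_monom: "finite I \<Longrightarrow> coeff (\<Sum>i\<in>I. monom (c i) i) k = (if k \<in> I then c k else 0)"
  by (simp add: coeff_sum)

text \<open>The convolution gives the low coefficients of a product \<open>P * Q\<close>. On the
  circle of radius \<open>r\<close> the factor \<open>P\<close> is at most \<open>B\<close>, and
  Parseval translates this pointwise estimate into one for coefficients.\<close>

lemma poly_convolution_bound:
  fixes f c :: "nat \<Rightarrow> complex"
  assumes "0 \<le> r" "J \<le> N"
    and B: "\<And>z. cmod z = r \<Longrightarrow> cmod (\<Sum>k\<le>N. f k * z ^ k) \<le> B"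
  shows "(\<Sum>j\<le>J. (cmod (\<Sum>i\<le>j. f i * c (j - i)) * r ^ j)\<^sup>2) \<le> B\<^sup>2 * (\<Sum>j\<le>J. (cmod (c j) * r ^ j)\<^sup>2)"
proof -
  define P where "P = (\<Sum>k\<le>N. monom (f k) k)"
  define Q where "Q = (\<Sum>k\<le>J. monom (c k) k)"
  \<comment> \<open>More sample points than the degree of \<open>P * Q\<close>, so that Parseval
    applies to the product as well as to \<open>Q\<close>.\<close>
  define L where "L = Suc (N + J)"
  have P: "coeff P k = (if k \<le> N then f k else 0)" for k
    by (simp add: P_def coeff_sum_monom)
  have Q: "coeff Q k = (if k \<le> J then c k else 0)" for k
    by (simp add: Q_def coeff_sum_monom)
  have "degree P \<le> N" "degree Q \<le> J"
    by (auto intro!: degree_le simp: P Q)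
  then have deg: "degree (P * Q) < L" "degree Q < L"
    using degree_mult_le[of P Q] by (auto simp: L_def)
  \<comment> \<open>Because \<open>J \<le> N\<close>, truncating the two sequences does not affect
    the coefficients up to \<open>J\<close>.\<close>
  have PQ: "coeff (P * Q) j = (\<Sum>i\<le>j. f i * c (j - i))" if "j \<le> J" for j
    unfolding coeff_mult using that assms(2) by (intro sum.cong refl) (auto simp: P Q)
  have Pz: "cmod (poly P z) \<le> B" if "cmod z = r" for z
    using B[OF that] by (simp add: P_def poly_sum poly_monom)
  let ?z = "\<lambda>j. complex_of_real r * cis (2 * pi * real j / real L)"
  have "real L * (\<Sum>j\<le>J. (cmod (\<Sum>i\<le>j. f i * c (j - i)) * r ^ j)\<^sup>2)
      = real L * (\<Sum>j\<le>J. (cmod (coeff (P * Q) j * of_real r ^ j))\<^sup>2)"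
    using assms(1) by (simp add: PQ norm_mult norm_power)
  also have "\<dots> \<le> real L * (\<Sum>j<L. (cmod (coeff (P * Q) j * of_real r ^ j))\<^sup>2)"
    by (intro mult_left_mono sum_mono2) (auto simp: L_def)
  also have "\<dots> = (\<Sum>j<L. (cmod (poly (P * Q) (?z j)))\<^sup>2)"
    using Parseval_poly[OF deg(1), of r] by simp
  also have "\<dots> \<le> (\<Sum>j<L. B\<^sup>2 * (cmod (poly Q (?z j)))\<^sup>2)"
    by (intro sum_mono) (auto simp: norm_mult power_mult_distrib assms(1) intro!: mult_right_mono power_mono Pz)
  also have "\<dots> = B\<^sup>2 * (real L * (\<Sum>k<L. (cmod (coeff Q k * of_real r ^ k))\<^sup>2))"
    using Parseval_poly[OF deg(2), of r] by (simp flip: sum_distrib_left)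
  also have "(\<Sum>k<L. (cmod (coeff Q k * of_real r ^ k))\<^sup>2) = (\<Sum>j\<le>J. (cmod (c j) * r ^ j)\<^sup>2)"
    using assms(1) by (intro sum.mono_neutral_cong_right) (auto simp: L_def Q norm_mult norm_power)
  finally have "real L * (\<Sum>j\<le>J. (cmod (\<Sum>i\<le>j. f i * c (j - i)) * r ^ j)\<^sup>2)
      \<le> real L * (B\<^sup>2 * (\<Sum>j\<le>J. (cmod (c j) * r ^ j)\<^sup>2))"
    by (simp add: mult_ac)
  then show ?thesis
    by (simp add: L_def)
qed

text \<open>Taylor polynomials may exceed \<open>C\<close> on the disc, but on the circle of radius
  \<open>r < 1\<close> the excess is at most a tail of an absolutely convergent series. The degree
  \<open>N\<close> tends to infinity for fixed \<open>r\<close>, and only then does \<open>r\<close>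
  tend to 1.\<close>

lemma bounded_analytic_convolution_bound:
  fixes f c :: "nat \<Rightarrow> complex"
  assumes summ: "\<And>z. z \<in> ball 0 1 \<Longrightarrow> summable (\<lambda>k. f k * z ^ k)"
    and C: "\<And>z. z \<in> ball 0 1 \<Longrightarrow> cmod (\<Sum>k. f k * z ^ k) \<le> C"
  shows "(\<Sum>j\<le>J. (cmod (\<Sum>i\<le>j. f i * c (j - i)))\<^sup>2) \<le> C\<^sup>2 * (\<Sum>j\<le>J. (cmod (c j))\<^sup>2)"
proof -
  define g where "g j = cmod (\<Sum>i\<le>j. f i * c (j - i))" for j
  have r: "(\<Sum>j\<le>J. (g j * r ^ j)\<^sup>2) \<le> C\<^sup>2 * (\<Sum>j\<le>J. (cmod (c j))\<^sup>2)" if "0 < r" "r < 1" for r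
  proof -
    define t where "t k = cmod (f k) * r ^ k" for k
    \<comment> \<open>Convergence at the midpoint of \<open>r\<close> and 1 gives absolute
      convergence at \<open>r\<close>.\<close>
    have t: "summable t"
      unfolding t_def
      using powser_insidea[OF summ[of "of_real ((r + 1) / 2)"], of "of_real r"] that
      by (simp add: norm_mult norm_power)
    have "(\<Sum>j\<le>J. (g j * r ^ j)\<^sup>2) \<le> (C + (\<Sum>k. t (k + Suc N)))\<^sup>2 * (\<Sum>j\<le>J. (cmod (c j) * r ^ j)\<^sup>2)"
      if "N \<ge> J" for N
      unfolding g_def
    proof (rule poly_convolution_bound)
      show "cmod (\<Sum>k\<le>N. f k * z ^ k) \<le> C + (\<Sum>k. t (k + Suc N))" if "cmod z = r" for z
      proof -
        have z: "z \<in> ball 0 1"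
          using that \<open>r < 1\<close> by simp
        have tz: "cmod (f k * z ^ k) = t k" for k
          using that by (simp add: t_def norm_mult norm_power)
        have tN: "summable (\<lambda>k. t (k + Suc N))"
          using t by (rule summable_ignore_initial_segment)
        have "(\<Sum>k\<le>N. f k * z ^ k) = (\<Sum>k. f k * z ^ k) - (\<Sum>k. f (k + Suc N) * z ^ (k + Suc N))"
          using suminf_split_initial_segment[OF summ[OF z], of "Suc N"]
          by (simp add: lessThan_Suc_atMost del: power_Suc sum.lessThan_Suc)
        also have "cmod \<dots> \<le> cmod (\<Sum>k. f k * z ^ k) + cmod (\<Sum>k. f (k + Suc N) * z ^ (k + Suc N))"
          by (rule norm_triangle_ineq4)
        also have "\<dots> \<le> C + (\<Sum>k. t (k + Suc N))"
          using summable_norm[of "\<lambda>k. f (k + Suc N) * z ^ (k + Suc N)"] tN C[OF z]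
          unfolding tz by linarith
        finally show ?thesis .
      qed
    qed (use that \<open>0 < r\<close> in auto)
    moreover have "(\<lambda>N. (C + (\<Sum>k. t (k + Suc N)))\<^sup>2 * (\<Sum>j\<le>J. (cmod (c j) * r ^ j)\<^sup>2))
        \<longlonglongrightarrow> (C + 0)\<^sup>2 * (\<Sum>j\<le>J. (cmod (c j) * r ^ j)\<^sup>2)"
      by (intro tendsto_intros LIMSEQ_Suc suminf_exist_split2[OF t])
    ultimately have "(\<Sum>j\<le>J. (g j * r ^ j)\<^sup>2) \<le> C\<^sup>2 * (\<Sum>j\<le>J. (cmod (c j) * r ^ j)\<^sup>2)"
      by (intro LIMSEQ_le_const) auto
    also have "\<dots> \<le> C\<^sup>2 * (\<Sum>j\<le>J. (cmod (c j))\<^sup>2)"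
      using that by (intro mult_left_mono sum_mono power_mono mult_left_le power_le_one) auto
    finally show ?thesis .
  qed
  \<comment> \<open>The bound no longer depends on \<open>r\<close>, and the left side is a finite
    sum continuous in \<open>r\<close>.\<close>
  have "((\<lambda>r. \<Sum>j\<le>J. (g j * r ^ j)\<^sup>2) \<longlongrightarrow> (\<Sum>j\<le>J. (g j * 1 ^ j)\<^sup>2)) (at_left (1::real))"
    by (intro tendsto_intros)
  moreover have "\<forall>\<^sub>F r in at_left 1. (\<Sum>j\<le>J. (g j * r ^ j)\<^sup>2) \<le> C\<^sup>2 * (\<Sum>j\<le>J. (cmod (c j))\<^sup>2)"
    using eventually_at_left_real[of 0 1] by (auto elim!: eventually_mono intro: r)
  ultimately have "(\<Sum>j\<le>J. (g j * 1 ^ j)\<^sup>2) \<le> C\<^sup>2 * (\<Sum>j\<le>J. (cmod (c j))\<^sup>2)"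
    by (intro tendsto_upperbound) auto
  then show ?thesis
    by (simp add: g_def)
qed

subsection \<open>Operators with a p-invariant symbol\<close>

lemma multiplicity_mult_power:
  fixes p m :: nat
  assumes "p > 0" "\<not> p dvd m"
  shows "multiplicity p (m * p ^ j) = j"
  using assms by (intro multiplicity_eqI) auto

lemma multiplicity_decompose_nat:
  fixes p n :: nat
  assumes "p \<ge> 2" "n \<ge> 1"
  obtains m where "m \<ge> 1" "\<not> p dvd m" "n = m * p ^ multiplicity p n"
proof -
  obtain m where "n = p ^ multiplicity p n * m" "\<not> p dvd m"
    using multiplicity_decompose'[of n p] assms by auto
  then show ?thesis
    using that[of m] assms by (cases "m = 0") (auto simp: mult.commute)
qed

text \<open>With \<open>p \<ge> 2\<close> the indices \<open>n * p ^ k\<close> are distinct for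
  distinct \<open>k\<close>, so each chain is an infinite orthonormal sequence.\<close>

locale multiplicative_basis =
  fixes e :: "nat \<Rightarrow> 'a :: complex_hilbert" and p :: nat
  assumes basis: "orthonormal_basis e" and p: "p \<ge> 2"
begin

lemmas orthonormal_e = orthonormal_basis_orthonormal[OF basis]

text \<open>Here \<open>f k n\<close> is the \<open>k\<close>-th Taylor coefficient of the symbol at
  \<open>n\<close>, constant term included. Invariance makes the symbol the same along a whole
  chain.\<close>

definition invariant_symbol :: "(nat \<Rightarrow> nat \<Rightarrow> complex) \<Rightarrow> bool" where
  "invariant_symbol f \<longleftrightarrow> (\<forall>k. \<forall>n\<ge>1. f k (p * n) = f k n)"

lemma invariant_symbol_power:
  assumes "invariant_symbol f" "n \<ge> 1"
  shows "f k (n * p ^ j) = f k n"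
proof (induction j)
  case (Suc j)
  have "f k (p * (n * p ^ j)) = f k (n * p ^ j)"
    using assms p unfolding invariant_symbol_def by simp
  then show ?case
    using Suc by (simp add: mult_ac)
qed simp

text \<open>The \<open>N\<close>-th coordinate of \<open>(\<Sum>j. diag (f j) M\<^bsub>p^j\<^esub>) x\<close>, a finite sum.\<close>

definition coord :: "(nat \<Rightarrow> nat \<Rightarrow> complex) \<Rightarrow> 'a \<Rightarrow> nat \<Rightarrow> complex" where
  "coord f x N = (\<Sum>j\<le>multiplicity p N. f j N * cinner x (e (N div p ^ j)))"

text \<open>The operator is specified through its coordinates, each a finite sum, so that no
  convergence of an operator series enters.\<close>

definition has_symbol :: "('a \<Rightarrow>\<^sub>L 'a) \<Rightarrow> (nat \<Rightarrow> nat \<Rightarrow> complex) \<Rightarrow> bool" where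
  "has_symbol T f \<longleftrightarrow>
     complex_linear T \<and> (\<forall>x. \<forall>N\<ge>1. cinner (blinfun_apply T x) (e N) = coord f x N)"

text \<open>By invariance the coefficients can be read at \<open>m\<close>. What remains is a
  convolution, the action of a lower triangular Toeplitz matrix.\<close>

lemma coord_chain:
  assumes "invariant_symbol f" "m \<ge> 1" "\<not> p dvd m"
  shows "coord f x (m * p ^ J) = (\<Sum>j\<le>J. f j m * cinner x (e (m * p ^ (J - j))))"
proof -
  have "m * p ^ J div p ^ j = m * p ^ (J - j)" if "j \<le> J" for j
    using that p by (simp add: power_diff div_mult_swap le_imp_power_dvd)
  then show ?thesis
    using assms p
    by (simp add: coord_def multiplicity_mult_power invariant_symbol_power)
qed

lemma coord_basis:
  assumes "invariant_symbol f" "n \<ge> 1"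
  shows "coord f (e n) (n * p ^ k) = f k n"
proof -
  let ?N = "n * p ^ k"
  have "coord f (e n) ?N = (\<Sum>j\<le>multiplicity p ?N. if j = k then f j ?N else 0)"
    unfolding coord_def
  proof (intro sum.cong refl)
    fix j
    assume "j \<in> {..multiplicity p ?N}"
    then obtain q where q: "?N = p ^ j * q"
      using multiplicity_dvd'[of j p ?N] by auto
    moreover have "q \<ge> 1"
      using q assms(2) p by (cases "q = 0") auto
    moreover have "q = n \<longleftrightarrow> j = k"
      using q assms(2) p by (auto simp: mult.commute)
    ultimately show "f j ?N * cinner (e n) (e (?N div p ^ j)) = (if j = k then f j ?N else 0)"
      using orthonormal_e assms(2) p by (auto simp: orthonormal_def)
  qed
  \<comment> \<open>Since \<open>n\<close> may itself be divisible by \<open>p\<close>, only an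
    inequality holds; it ensures that the term \<open>j = k\<close> occurs in the sum.\<close>
  moreover have "k \<le> multiplicity p ?N"
    using assms(2) p by (intro multiplicity_geI) auto
  ultimately show ?thesis
    using assms by (simp add: invariant_symbol_power)
qed

lemma coord_basis_eq_0:
  assumes "n \<ge> 1" "N \<ge> 1" "\<And>k. N \<noteq> n * p ^ k"
  shows "coord f (e n) N = 0"
  unfolding coord_def
proof (intro sum.neutral ballI)
  fix j
  assume "j \<in> {..multiplicity p N}"
  then obtain q where q: "N = p ^ j * q"
    using multiplicity_dvd'[of j p N] by auto
  moreover have "q \<ge> 1"
    using q assms(2) by (cases "q = 0") auto
  moreover have "q \<noteq> n"
    using q assms(3)[of j] by (auto simp: mult.commute)
  ultimately show "f j N * cinner (e n) (e (N div p ^ j)) = 0"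
    using orthonormal_e assms(1) p by (auto simp: orthonormal_def)
qed

lemma orthonormal_chain: "n \<ge> 1 \<Longrightarrow> orthonormal (\<lambda>k. e (n * p ^ k)) UNIV"
  using p by (intro orthonormal_compose[OF orthonormal_e]) (auto intro!: injI)

text \<open>Links \<open>has_symbol\<close> to the defining series of the theorem. The
  \<open>f k n\<close> are coordinates of the image of \<open>e n\<close>, hence square summable by
  Bessel; the series converges by Riesz-Fischer, and comparing coordinates identifies its
  sum.\<close>

lemma has_symbol_sums:
  assumes T: "has_symbol T f" and f: "invariant_symbol f" and n: "n \<ge> 1"
  shows "(\<lambda>k. f k n *\<^sub>C e (n * p ^ k)) sums blinfun_apply T (e n)"
proof -
  let ?u = "\<lambda>k. e (n * p ^ k)" and ?y = "blinfun_apply T (e n)"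
  have ge1: "n * p ^ k \<ge> 1" for k
    using n p by simp
  have T_coord: "cinner ?y (e N) = coord f (e n) N" if "N \<ge> 1" for N
    using T that unfolding has_symbol_def by blast
  have c: "f k n = cinner ?y (?u k)" for k
    by (simp add: T_coord[OF ge1] coord_basis[OF f n])
  have "summable (\<lambda>k. (cmod (f k n))\<^sup>2)"
    unfolding c
    by (intro summableI_nonneg_bounded[where x = "(norm ?y)\<^sup>2"] zero_le_power2 Bessel_inequality
        orthonormal_subset[OF orthonormal_chain[OF n]]) auto
  then have summ: "summable (\<lambda>k. f k n *\<^sub>C ?u k)"
    by (rule Riesz_Fischer[OF orthonormal_chain[OF n]])
  have "(\<Sum>k. f k n *\<^sub>C ?u k) = ?y"
  proof (rule orthonormal_basis_eqI[OF basis])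
    fix N :: nat
    assume N: "N \<ge> 1"
    show "cinner (\<Sum>k. f k n *\<^sub>C ?u k) (e N) = cinner ?y (e N)"
    proof (cases "\<exists>k. N = n * p ^ k")
      case True
      then show ?thesis
        using cinner_orthonormal_suminf[OF orthonormal_chain[OF n] summ] c by auto
    next
      case False
      have "(\<lambda>k. cinner (f k n *\<^sub>C ?u k) (e N)) sums cinner (\<Sum>k. f k n *\<^sub>C ?u k) (e N)"
        by (rule bounded_linear.sums[OF bounded_linear_cinner_left summable_sums[OF summ]])
      moreover have "cinner (?u k) (e N) = 0" for k
        using orthonormal_e ge1[of k] N False unfolding orthonormal_def by auto
      ultimately have "cinner (\<Sum>k. f k n *\<^sub>C ?u k) (e N) = 0"
        using sums_unique2[OF _ sums_zero] by (simp add: cinner_scaleC_left)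
      then show ?thesis
        using T_coord[OF N] coord_basis_eq_0[OF n N] False by simp
    qed
  qed
  then show ?thesis
    using summable_sums[OF summ] by simp
qed

text \<open>Grouping indices by chain reduces this to the convolution bound, applied to the
  coordinates of \<open>x\<close> along each chain. Bessel's inequality then adds the chains
  up.\<close>

lemma coord_square_sum_le:
  assumes f: "invariant_symbol f"
    and summ: "\<And>n z. n \<ge> 1 \<Longrightarrow> z \<in> ball 0 1 \<Longrightarrow> summable (\<lambda>k. f k n * z ^ k)"
    and C: "\<And>n z. n \<ge> 1 \<Longrightarrow> z \<in> ball 0 1 \<Longrightarrow> cmod (\<Sum>k. f k n * z ^ k) \<le> C"
  shows "(\<Sum>N\<in>{1..K}. (cmod (coord f x N))\<^sup>2) \<le> C\<^sup>2 * (norm x)\<^sup>2"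
proof -
  define R where "R = {m\<in>{1..K}. \<not> p dvd m}"
  define h where "h = (\<lambda>(m, j). m * p ^ j)"
  have inj: "inj_on h (R \<times> {..K})"
  proof (rule inj_onI, clarify)
    fix m j m' j'
    assume "m \<in> R" "m' \<in> R" "h (m, j) = h (m', j')"
    then have eq: "m * p ^ j = m' * p ^ j'" and "\<not> p dvd m" "\<not> p dvd m'"
      by (simp_all add: h_def R_def)
    then have "j = j'"
      using p multiplicity_mult_power[of p m j] multiplicity_mult_power[of p m' j'] by simp
    then show "m = m' \<and> j = j'"
      using eq p by simp
  qed
  \<comment> \<open>The image of the rectangle may overshoot \<open>{1..K}\<close>, which is
    harmless for nonnegative terms. It covers \<open>{1..K}\<close> because the root
    \<open>m\<close> is at most \<open>N\<close> and the exponent is below its power of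
    \<open>p\<close>, itself at most \<open>N\<close>.\<close>
  have sub: "{1..K} \<subseteq> h ` (R \<times> {..K})"
  proof
    fix N
    assume N: "N \<in> {1..K}"
    then obtain m where m: "m \<ge> 1" "\<not> p dvd m" "N = m * p ^ multiplicity p N"
      using multiplicity_decompose_nat[OF p, of N] by auto
    have "m * 1 \<le> m * p ^ multiplicity p N" "1 * p ^ multiplicity p N \<le> m * p ^ multiplicity p N"
      using m(1) p by (intro mult_le_mono; simp)+
    moreover have "multiplicity p N < p ^ multiplicity p N"
      using p by (intro power_gt_expt) auto
    ultimately have "m \<le> K" "multiplicity p N \<le> K"
      using N m(3) by auto
    then show "N \<in> h ` (R \<times> {..K})"
      using m by (intro image_eqI[of _ _ "(m, multiplicity p N)"]) (auto simp: h_def R_def)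
  qed
  have fin: "finite (R \<times> {..K})"
    by (simp add: R_def)
  have sum_h: "(\<Sum>N\<in>h ` (R \<times> {..K}). \<phi> N) = (\<Sum>m\<in>R. \<Sum>j\<le>K. \<phi> (m * p ^ j))" for \<phi> :: "nat \<Rightarrow> real"
    by (simp add: sum.reindex[OF inj] sum.cartesian_product) (simp add: h_def case_prod_unfold)
  have "(\<Sum>N\<in>{1..K}. (cmod (coord f x N))\<^sup>2) \<le> (\<Sum>N\<in>h ` (R \<times> {..K}). (cmod (coord f x N))\<^sup>2)"
    using fin sub by (intro sum_mono2) auto
  also have "\<dots> = (\<Sum>m\<in>R. \<Sum>j\<le>K. (cmod (coord f x (m * p ^ j)))\<^sup>2)"
    by (rule sum_h)
  also have "\<dots> \<le> (\<Sum>m\<in>R. C\<^sup>2 * (\<Sum>j\<le>K. (cmod (cinner x (e (m * p ^ j))))\<^sup>2))"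
  proof (intro sum_mono)
    fix m
    assume "m \<in> R"
    then have m: "m \<ge> 1" "\<not> p dvd m"
      by (auto simp: R_def)
    show "(\<Sum>j\<le>K. (cmod (coord f x (m * p ^ j)))\<^sup>2)
        \<le> C\<^sup>2 * (\<Sum>j\<le>K. (cmod (cinner x (e (m * p ^ j))))\<^sup>2)"
      unfolding coord_chain[OF f m]
      using bounded_analytic_convolution_bound[OF summ[OF m(1)] C[OF m(1)]] .
  qed
  also have "\<dots> = C\<^sup>2 * (\<Sum>N\<in>h ` (R \<times> {..K}). (cmod (cinner x (e N)))\<^sup>2)"
    by (simp add: sum_h flip: sum_distrib_left)
  also have "\<dots> \<le> C\<^sup>2 * (norm x)\<^sup>2"
    using fin p
    by (intro mult_left_mono Bessel_inequality orthonormal_subset[OF orthonormal_e])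
      (auto simp: h_def R_def)
  finally show ?thesis .
qed

text \<open>The prescribed coordinates are square summable, so Riesz-Fischer defines the image of
  each vector. Linearity follows by comparing coordinates, the norm bound from the partial
  sums.\<close>

lemma ex_has_symbol:
  assumes f: "invariant_symbol f"
    and summ: "\<And>n z. n \<ge> 1 \<Longrightarrow> z \<in> ball 0 1 \<Longrightarrow> summable (\<lambda>k. f k n * z ^ k)"
    and C: "\<And>n z. n \<ge> 1 \<Longrightarrow> z \<in> ball 0 1 \<Longrightarrow> cmod (\<Sum>k. f k n * z ^ k) \<le> C"
  obtains T where "has_symbol T f" "norm T \<le> C"
proof -
  have "C \<ge> 0"
    using order_trans[OF norm_ge_zero C[of 1 0]] by simp
  \<comment> \<open>Series start at 0 and the basis at 1, hence the shift by
    \<open>Suc\<close>.\<close>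
  define u where "u x N = coord f x (Suc N) *\<^sub>C e (Suc N)" for x N
  define T where "T x = (\<Sum>N. u x N)" for x
  have ons: "orthonormal (\<lambda>N. e (Suc N)) UNIV"
    by (intro orthonormal_compose[OF orthonormal_e]) auto
  have bound: "(\<Sum>N<K. (cmod (coord f x (Suc N)))\<^sup>2) \<le> C\<^sup>2 * (norm x)\<^sup>2" for x K
    using coord_square_sum_le[OF f summ C, of x K]
    by (simp add: sum.atLeast1_atMost_eq)
  have "summable (\<lambda>N. (cmod (coord f x (Suc N)))\<^sup>2)" for x
    by (rule summableI_nonneg_bounded[OF _ bound]) simp
  then have u: "summable (u x)" for x
    unfolding u_def by (rule Riesz_Fischer[OF ons])
  have T: "cinner (T x) (e N) = coord f x N" if "N \<ge> 1" for x N
    using cinner_orthonormal_suminf[OF ons u[unfolded u_def], of x "N - 1"] that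
    by (simp add: T_def u_def)
  have "norm (\<Sum>N<K. u x N) \<le> C * norm x" for x K
  proof (rule power2_le_imp_le)
    show "(norm (\<Sum>N<K. u x N))\<^sup>2 \<le> (C * norm x)\<^sup>2"
      unfolding u_def using bound[where K = K and x = x]
      by (subst norm_orthonormal_sum[OF orthonormal_subset[OF ons]])
        (auto simp: power_mult_distrib)
  qed (use \<open>C \<ge> 0\<close> in simp)
  then have norm_T: "norm (T x) \<le> C * norm x" for x
    using Lim_bounded[OF tendsto_norm[OF summable_LIMSEQ[OF u[of x]]]] by (simp add: T_def)
  have add: "T (x + y) = T x + T y" for x y
    by (rule orthonormal_basis_eqI[OF basis])
      (simp add: T cinner_add_left coord_def distrib_left sum.distrib)
  have scaleC: "T (c *\<^sub>C x) = c *\<^sub>C T x" for c x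
    by (rule orthonormal_basis_eqI[OF basis])
      (simp add: T cinner_scaleC_left coord_def sum_distrib_left mult_ac)
  have T_linear: "bounded_linear T"
    by (rule bounded_linear_intro[where K = C])
      (use norm_T in \<open>auto simp: add scaleR_scaleC scaleC mult.commute\<close>)
  show ?thesis
  proof
    show "has_symbol (Blinfun T) f"
      using T scaleC
      by (simp add: has_symbol_def complex_linear_def bounded_linear_Blinfun_apply[OF T_linear])
    show "norm (Blinfun T) \<le> C"
      using \<open>C \<ge> 0\<close> norm_T
      by (intro norm_blinfun_bound) (simp_all add: bounded_linear_Blinfun_apply[OF T_linear])
  qed
qed

text \<open>On the chain of \<open>m\<close> the operator with symbol \<open>f\<close> multiplies the formal power series
  \<open>\<Sum>j. \<langle>x, e(m p^j)\<rangle> X^j\<close> by \<open>\<Sum>k. f\<^sub>k(m) X^k\<close>.\<close>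

lemma has_symbol_fps:
  assumes "has_symbol T f" "invariant_symbol f" "m \<ge> 1" "\<not> p dvd m"
  shows "Abs_fps (\<lambda>j. cinner (blinfun_apply T x) (e (m * p ^ j)))
    = Abs_fps (\<lambda>k. f k m) * Abs_fps (\<lambda>j. cinner x (e (m * p ^ j)))"
proof -
  have "cinner (blinfun_apply T x) (e (m * p ^ j)) = coord f x (m * p ^ j)" for j
    using assms(1,3) p unfolding has_symbol_def by simp
  then show ?thesis
    using assms(2-4) by (intro fps_ext) (simp add: coord_chain fps_mult_nth atLeast0AtMost)
qed

text \<open>On each chain the composition multiplies by the product of the two symbols, which is 1,
  and every index lies on some chain.\<close>

lemma has_symbol_compose_id:
  assumes "has_symbol T f" "has_symbol S g" "invariant_symbol f" "invariant_symbol g"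
    and inv: "\<And>n. n \<ge> 1 \<Longrightarrow> Abs_fps (\<lambda>k. f k n) * Abs_fps (\<lambda>k. g k n) = 1"
  shows "T o\<^sub>L S = id_blinfun"
proof (rule blinfun_eqI, rule orthonormal_basis_eqI[OF basis])
  fix x and N :: nat
  assume "N \<ge> 1"
  then obtain m where m: "m \<ge> 1" "\<not> p dvd m" and N: "N = m * p ^ multiplicity p N"
    using multiplicity_decompose_nat[OF p] by metis
  let ?X = "\<lambda>x. Abs_fps (\<lambda>j. cinner x (e (m * p ^ j)))"
  have "?X (blinfun_apply T (blinfun_apply S x)) = ?X x"
    unfolding has_symbol_fps[OF assms(1,3) m] has_symbol_fps[OF assms(2,4) m]
    by (simp add: inv[OF m(1)] flip: mult.assoc)
  then have "cinner (blinfun_apply T (blinfun_apply S x)) (e (m * p ^ j)) = cinner x (e (m * p ^ j))" for j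
    by (metis fps_nth_Abs_fps)
  then show "cinner (blinfun_apply (T o\<^sub>L S) x) (e N) = cinner (blinfun_apply id_blinfun x) (e N)"
    by (subst (1 2) N) (simp add: blinfun_compose.rep_eq)
qed

text \<open>The vector \<open>v = \<Sum>j. cnj z^j e(m p^j)\<close> is an eigenvector of the adjoint of \<open>T\<close>; the
  eigenvalue equation is used here in the form \<open>\<langle>T x, v\<rangle> = (\<Sum>k. f\<^sub>k(m) z^k) \<langle>x, v\<rangle>\<close>.\<close>

lemma right_inverse_norm_ge:
  assumes T: "has_symbol T f" and f: "invariant_symbol f"
    and summ: "\<And>n z. n \<ge> 1 \<Longrightarrow> z \<in> ball 0 1 \<Longrightarrow> summable (\<lambda>k. f k n * z ^ k)"
    and TS: "T o\<^sub>L S = id_blinfun" and n: "n \<ge> 1" and z: "z \<in> ball 0 1"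
  shows "1 \<le> cmod (\<Sum>k. f k n * z ^ k) * norm S"
proof -
  obtain m where m: "m \<ge> 1" "\<not> p dvd m" and nm: "n = m * p ^ multiplicity p n"
    using multiplicity_decompose_nat[OF p n] by metis
  define \<alpha> where "\<alpha> = (\<Sum>k. f k m * z ^ k)"
  have fn: "f k n = f k m" for k
    using invariant_symbol_power[OF f m(1)] nm by metis
  let ?u = "\<lambda>j. e (m * p ^ j)"
  have z1: "cmod z < 1"
    using z by simp
  have "(cmod z)\<^sup>2 < 1"
    using z1 by (simp add: power_less_one_iff)
  then have "summable (\<lambda>j. (cmod (cnj z ^ j))\<^sup>2)"
    by (simp add: norm_power power2_eq_square summable_geometric flip: power_mult_distrib)
  then have summ_v: "summable (\<lambda>j. cnj z ^ j *\<^sub>C ?u j)"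
    by (rule Riesz_Fischer[OF orthonormal_chain[OF m(1)]])
  define v where "v = (\<Sum>j. cnj z ^ j *\<^sub>C ?u j)"
  have v: "(\<lambda>j. cinner x (?u j) * z ^ j) sums cinner x v" for x
    using bounded_linear.sums[OF bounded_linear_cinner_right summable_sums[OF summ_v], of x]
    by (simp add: v_def cinner_scaleC_right mult.commute)
  have v_abs: "summable (\<lambda>j. cmod (cinner x (?u j) * z ^ j))" for x
  proof (rule summable_comparison_test)
    have "cmod (cinner x (?u j)) \<le> norm x" for j
    proof -
      have "norm (?u j) = 1"
        using orthonormal_chain[OF m(1)] cinner_self[of "?u j"] norm_ge_zero[of "?u j"]
        unfolding orthonormal_def by (auto simp: power2_eq_1_iff simp flip: of_real_power)
      then show ?thesis
        using cinner_Cauchy_Schwarz[of x "?u j"] by simp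
    qed
    then show "\<exists>N. \<forall>j\<ge>N. norm (cmod (cinner x (?u j) * z ^ j)) \<le> norm x * cmod z ^ j"
      by (auto simp: norm_mult norm_power intro!: mult_right_mono)
    show "summable (\<lambda>j. norm x * cmod z ^ j)"
      using z1 by (intro summable_mult summable_geometric) simp
  qed
  \<comment> \<open>Absolute convergence at \<open>z\<close> comes from convergence at a real point
    between |z| and 1; the Cauchy product below relies on it.\<close>
  have f_abs: "summable (\<lambda>k. cmod (f k m * z ^ k))"
    using powser_insidea[OF summ[of m "of_real ((1 + cmod z) / 2)"], of z] m z1
    by (simp flip: of_real_add)
  have eigen: "cinner (blinfun_apply T x) v = \<alpha> * cinner x v" for x
  proof -
    have "cinner (blinfun_apply T x) (?u j) * z ^ j
        = (\<Sum>i\<le>j. (f i m * z ^ i) * (cinner x (?u (j - i)) * z ^ (j - i)))" for j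
    proof -
      have "cinner (blinfun_apply T x) (?u j) = coord f x (m * p ^ j)"
        using T m p unfolding has_symbol_def by simp
      also have "\<dots> * z ^ j
          = (\<Sum>i\<le>j. (f i m * z ^ i) * (cinner x (?u (j - i)) * z ^ (j - i)))"
        unfolding coord_chain[OF f m] sum_distrib_right
        by (intro sum.cong refl) (simp add: mult_ac flip: power_add)
      finally show ?thesis .
    qed
    then show ?thesis
      using Cauchy_product_sums[OF f_abs v_abs[of x]] v[of "blinfun_apply T x"] sums_unique[OF v[of x]]
      by (simp add: \<alpha>_def sums_iff)
  qed
  have "cinner v (?u 0) = 1"
    unfolding v_def
    using cinner_orthonormal_suminf[OF orthonormal_chain[OF m(1)] summ_v, of 0] by simp
  then have "v \<noteq> 0"
    by auto
  \<comment> \<open>Testing the eigenvalue equation on \<open>S v\<close> gives |v|^2 = \<alpha> <S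
    v, v>, to which Cauchy-Schwarz applies.\<close>
  have "blinfun_apply T (blinfun_apply S v) = v"
    using TS by (metis blinfun_apply_blinfun_compose blinfun_apply_id_blinfun id_apply)
  then have "complex_of_real ((norm v)\<^sup>2) = \<alpha> * cinner (blinfun_apply S v) v"
    using eigen[of "blinfun_apply S v"] by (simp add: cinner_self)
  then have "(norm v)\<^sup>2 = cmod \<alpha> * cmod (cinner (blinfun_apply S v) v)"
    by (metis norm_mult norm_of_real abs_of_nonneg zero_le_power2)
  also have "\<dots> \<le> cmod \<alpha> * (norm S * norm v * norm v)"
    by (intro mult_left_mono order_trans[OF cinner_Cauchy_Schwarz] mult_right_mono norm_blinfun)
      simp_all
  finally have "1 * (norm v)\<^sup>2 \<le> (cmod \<alpha> * norm S) * (norm v)\<^sup>2"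
    by (simp add: power2_eq_square mult_ac)
  then show ?thesis
    using \<open>v \<noteq> 0\<close> by (simp add: \<alpha>_def fn)
qed

end

subsection \<open>Inverses\<close>

text \<open>The formal inverse exists since \<open>c 0 = f 0\<close> is nonzero. Near 0 it is the
  Taylor series of \<open>1 / f\<close>, which is holomorphic on the whole disc, so the series
  converges to \<open>1 / f\<close> there.\<close>

lemma inverse_power_series_sums:
  fixes c :: "nat \<Rightarrow> complex"
  assumes f: "\<And>z. z \<in> ball 0 1 \<Longrightarrow> (\<lambda>k. c k * z ^ k) sums f z"
    and nz: "\<And>z. z \<in> ball 0 1 \<Longrightarrow> f z \<noteq> 0" and z: "z \<in> ball 0 1"
  shows "(\<lambda>k. fps_nth (inverse (Abs_fps c)) k * z ^ k) sums inverse (f z)"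
    and "Abs_fps c * inverse (Abs_fps c) = 1"
proof -
  have "f 0 = c 0"
    using f[of 0] sums_unique2[OF _ powser_sums_zero] by simp
  then have c0: "fps_nth (Abs_fps c) 0 \<noteq> 0"
    using nz[of 0] by simp
  then show "Abs_fps c * inverse (Abs_fps c) = 1"
    by (metis inverse_mult_eq_1 mult.commute)
  have "\<forall>\<^sub>F z in nhds 0. z \<in> ball (0 :: complex) 1"
    by (intro eventually_nhds_in_open) auto
  then have "f has_fps_expansion Abs_fps c"
    by (intro has_fps_expansionI) (auto elim!: eventually_mono intro: f[simplified])
  then have "(\<lambda>z. inverse (f z)) has_fps_expansion inverse (Abs_fps c)"
    using c0 by (rule has_fps_expansion_inverse)
  then have "inverse (Abs_fps c) = fps_expansion (\<lambda>z. inverse (f z)) 0"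
    by (rule fps_expansion_eqI[symmetric])
  moreover have "(\<lambda>z. inverse (f z)) holomorphic_on ball 0 1"
    using f nz by (intro holomorphic_on_inverse power_series_holomorphic[of 0 1 c]) auto
  ultimately show "(\<lambda>k. fps_nth (inverse (Abs_fps c)) k * z ^ k) sums inverse (f z)"
    using holomorphic_power_series[of "\<lambda>z. inverse (f z)" 0 1 z] z
    by (simp add: fps_expansion_def)
qed

lemma is_inverse_op_unique: "is_inverse_op T S \<Longrightarrow> is_inverse_op T S' \<Longrightarrow> S = S'"
proof (rule blinfun_eqI)
  fix x
  assume "is_inverse_op T S" "is_inverse_op T S'"
  then have "blinfun_apply T (blinfun_apply S' x) = x" "blinfun_apply S (blinfun_apply T y) = y" for y
    unfolding is_inverse_op_def
    by (metis blinfun_apply_blinfun_compose blinfun_apply_id_blinfun id_apply)+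
  then show "blinfun_apply S x = blinfun_apply S' x"
    by metis
qed

lemma inverse_op_eq: "is_inverse_op T S \<Longrightarrow> inverse_op T = S"
  unfolding inverse_op_def by (intro the_equality is_inverse_op_unique)

section \<open>The invertibility criterion and the norm of the inverse\<close>

theorem lemma2p1:
  fixes e :: "nat \<Rightarrow> 'a :: complex_hilbert"
    and p :: nat
    and a :: "nat \<Rightarrow> nat \<Rightarrow> complex"
    and A M :: "nat \<Rightarrow> 'a \<Rightarrow>\<^sub>L 'a"
    and AA :: "complex \<Rightarrow> 'a \<Rightarrow>\<^sub>L 'a"
  assumes "orthonormal_basis e"
    and "\<forall>j\<ge>1. is_spread_shift e j (M j)"
    and "p \<ge> 2"
    and "\<forall>k\<ge>1. is_diag e (a k) (A k)"
    and "\<forall>k\<ge>1. \<forall>n\<ge>1. a k (p * n) = a k n"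
    and "\<forall>n\<ge>1. \<forall>z\<in>ball 0 1. summable (\<lambda>k. a (Suc k) n * z ^ Suc k)"
    and "\<forall>n\<ge>1. alpha a n analytic_on ball 0 1"
    and "bdd_above ((\<lambda>(z, n). cmod (alpha a n z)) ` (ball 0 1 \<times> {1..}))"
    and "\<forall>z\<in>ball 0 1. (\<lambda>k. z ^ Suc k *\<^sub>C A (Suc k)) sums (AA z - id_blinfun)"
    and "\<forall>z\<in>ball 0 1. is_diag e (\<lambda>n. alpha a n z) (AA z)"
    and "vector_analytic_on AA (ball 0 1)"
  shows "(\<exists>!T. is_series_operator e p A M T) \<and>
    (\<forall>T. is_series_operator e p A M T \<longrightarrow>
      (invertible_op T \<longleftrightarrow> lower_bound a > 0) \<and>
      (invertible_op T \<longrightarrow> norm (inverse_op T) = 1 / lower_bound a))"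
proof -
  interpret multiplicative_basis e p
    using assms(1,3) by unfold_locales
  \<comment> \<open>The identity is absorbed as the coefficient at \<open>k = 0\<close>, so that the
    symbol at \<open>n\<close> is all of \<open>alpha a n\<close>.\<close>
  define f where "f k n = (if k = 0 then 1 else a k n)" for k n
  have f: "invariant_symbol f"
    using assms(5) by (simp add: invariant_symbol_def f_def)
  have f_sums: "(\<lambda>k. f k n * z ^ k) sums alpha a n z" if "n \<ge> 1" "z \<in> ball 0 1" for n z
  proof -
    have "(\<lambda>k. f (Suc k) n * z ^ Suc k) sums (alpha a n z - 1)"
      using assms(6) that by (simp add: f_def alpha_def summable_sums)
    then show ?thesis
      using sums_Suc_iff[of "\<lambda>k. f k n * z ^ k" "alpha a n z - 1"] by (simp add: f_def)
  qed
  then have f_summ: "summable (\<lambda>k. f k n * z ^ k)"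
    and f_suminf: "(\<Sum>k. f k n * z ^ k) = alpha a n z" if "n \<ge> 1" "z \<in> ball 0 1" for n z
    using that by (simp_all add: sums_iff)
  obtain C where C: "cmod (alpha a n z) \<le> C" if "n \<ge> 1" "z \<in> ball 0 1" for n z
    using assms(8) unfolding bdd_above_def by fastforce
  obtain T where T: "has_symbol T f"
    by (rule ex_has_symbol[OF f f_summ, of C]) (simp_all add: f_suminf C)
  have term_e: "blinfun_apply (A (Suc k) o\<^sub>L M (p ^ Suc k)) (e n) = f (Suc k) n *\<^sub>C e (n * p ^ Suc k)"
    if n: "n \<ge> 1" for k n
  proof -
    have "p ^ Suc k \<ge> 1" "n * p ^ Suc k \<ge> 1"
      using n p by simp_all
    then have "blinfun_apply (M (p ^ Suc k)) (e n) = e (n * p ^ Suc k)"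
      and "blinfun_apply (A (Suc k)) (e (n * p ^ Suc k)) = a (Suc k) (n * p ^ Suc k) *\<^sub>C e (n * p ^ Suc k)"
      using assms(2,4) n unfolding is_spread_shift_def is_diag_def by (blast, simp)
    \<comment> \<open>The diagonal operator reads its entry at the shifted index; invariance moves
      it back to \<open>n\<close>.\<close>
    then show ?thesis
      using invariant_symbol_power[OF f n, of "Suc k" "Suc k"] by (simp add: f_def)
  qed
  have T_series: "is_series_operator e p A M T"
    unfolding is_series_operator_def
  proof (intro conjI allI impI)
    show "complex_linear T"
      using T by (simp add: has_symbol_def)
    fix n :: nat
    assume n: "n \<ge> 1"
    have "(\<lambda>k. f (Suc k) n *\<^sub>C e (n * p ^ Suc k)) sums (blinfun_apply T (e n) - e n)"
      using has_symbol_sums[OF T f n]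
        sums_Suc_iff[of "\<lambda>k. f k n *\<^sub>C e (n * p ^ k)" "blinfun_apply T (e n) - e n"]
      by (simp add: f_def scaleC_one)
    then show "(\<lambda>k. blinfun_apply (A (Suc k) o\<^sub>L M (p ^ Suc k)) (e n)) sums (blinfun_apply T (e n) - e n)"
      unfolding term_e[OF n] .
  qed
  have unique: "T' = T" if "is_series_operator e p A M T'" for T'
  proof (rule complex_linear_eqI[OF basis])
    show "complex_linear T'" "complex_linear T"
      using that T_series by (simp_all add: is_series_operator_def)
    fix n :: nat
    assume n: "n \<ge> 1"
    have "blinfun_apply T' (e n) - e n = blinfun_apply T (e n) - e n"
    proof (rule sums_unique2)
      show "(\<lambda>k. blinfun_apply (A (Suc k) o\<^sub>L M (p ^ Suc k)) (e n)) sums (blinfun_apply T' (e n) - e n)"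
        using that n unfolding is_series_operator_def by blast
      show "(\<lambda>k. blinfun_apply (A (Suc k) o\<^sub>L M (p ^ Suc k)) (e n)) sums (blinfun_apply T (e n) - e n)"
        using T_series n unfolding is_series_operator_def by blast
    qed
    then show "blinfun_apply T' (e n) = blinfun_apply T (e n)"
      by simp
  qed
  have lower_bound_le: "lower_bound a \<le> cmod (alpha a n z)" if "n \<ge> 1" "z \<in> ball 0 1" for n z
    unfolding lower_bound_def using that
    by (intro cINF_lower2[of _ _ "(z, n)"] bdd_belowI2[where m = 0]) auto
  have lower: "0 < lower_bound a \<and> 1 \<le> lower_bound a * norm S" if "T o\<^sub>L S = id_blinfun" for S
  proof -
    have ge: "1 \<le> cmod (alpha a n z) * norm S" if "n \<ge> 1" "z \<in> ball 0 1" for n z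
      using right_inverse_norm_ge[OF T f f_summ \<open>T o\<^sub>L S = id_blinfun\<close> that] f_suminf[OF that] by simp
    \<comment> \<open>For \<open>S = 0\<close> the estimate would read 1 \<le> 0.\<close>
    have S: "norm S > 0"
      using ge[of 1 0] by (cases "S = 0") auto
    have "1 / norm S \<le> lower_bound a"
      unfolding lower_bound_def
      using ge S by (intro cINF_greatest) (auto simp: divide_le_eq)
    then show ?thesis
      using S by (auto simp: divide_le_eq intro: less_le_trans[of 0 "1 / norm S"])
  qed
  have upper: "\<exists>S. is_inverse_op T S \<and> norm S \<le> 1 / lower_bound a" if pos: "lower_bound a > 0"
  proof -
    \<comment> \<open>The candidate inverse has symbol \<open>1 / alpha a n\<close>, whose modulus
      is at most \<open>1 / lower_bound a\<close>.\<close>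
    define g where "g k n = fps_nth (inverse (Abs_fps (\<lambda>k. f k n))) k" for k n
    have nz: "alpha a n z \<noteq> 0" if "n \<ge> 1" "z \<in> ball 0 1" for n z
      using lower_bound_le[OF that] pos by auto
    have g: "invariant_symbol g"
      using f by (simp add: invariant_symbol_def g_def)
    have g_sums: "(\<lambda>k. g k n * z ^ k) sums inverse (alpha a n z)"
      and inv: "Abs_fps (\<lambda>k. f k n) * Abs_fps (\<lambda>k. g k n) = 1" if "n \<ge> 1" "z \<in> ball 0 1" for n z
      using inverse_power_series_sums[OF f_sums[OF that(1)] nz[OF that(1)] that(2)]
      by (simp_all add: g_def fps_nth_inverse)
    have "cmod (\<Sum>k. g k n * z ^ k) \<le> 1 / lower_bound a" if "n \<ge> 1" "z \<in> ball 0 1" for n z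
      using le_imp_inverse_le[OF lower_bound_le[OF that] pos] sums_unique[OF g_sums[OF that], symmetric]
      by (simp add: norm_inverse inverse_eq_divide norm_divide)
    moreover have "summable (\<lambda>k. g k n * z ^ k)" if "n \<ge> 1" "z \<in> ball 0 1" for n z
      using g_sums[OF that] by (simp add: sums_iff)
    ultimately obtain S where S: "has_symbol S g" "norm S \<le> 1 / lower_bound a"
      using ex_has_symbol[OF g, of "1 / lower_bound a"] by blast
    \<comment> \<open>The product identity is formal; the point 0 only serves to instantiate
      \<open>z\<close>.\<close>
    have fg: "Abs_fps (\<lambda>k. f k n) * Abs_fps (\<lambda>k. g k n) = 1" if "n \<ge> 1" for n
      using inv[OF that, of 0] by simp
    have "T o\<^sub>L S = id_blinfun"
      by (rule has_symbol_compose_id[OF T S(1) f g fg])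
    moreover have "S o\<^sub>L T = id_blinfun"
      using fg by (intro has_symbol_compose_id[OF S(1) T g f]) (simp add: mult.commute)
    ultimately show ?thesis
      using S by (auto simp: is_inverse_op_def has_symbol_def)
  qed
  \<comment> \<open>Every inverse has norm at least \<open>1 / lower_bound a\<close>, the
    constructed one at most that, and uniqueness identifies them.\<close>
  have "norm (inverse_op T) = 1 / lower_bound a" if inv: "invertible_op T"
  proof -
    obtain S where S: "is_inverse_op T S"
      using inv unfolding invertible_op_def by blast
    then have "0 < lower_bound a \<and> 1 \<le> lower_bound a * norm S"
      by (intro lower) (simp add: is_inverse_op_def)
    moreover from this obtain S' where "is_inverse_op T S'" "norm S' \<le> 1 / lower_bound a"
      using upper by blast
    moreover have "S' = S"
      using \<open>is_inverse_op T S'\<close> S by (rule is_inverse_op_unique)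
    ultimately have "norm S = 1 / lower_bound a"
      by (intro antisym) (simp_all add: divide_le_eq mult.commute)
    then show ?thesis
      using inverse_op_eq[OF S] by simp
  qed
  moreover have "invertible_op T \<longleftrightarrow> lower_bound a > 0"
    using lower upper unfolding invertible_op_def is_inverse_op_def by blast
  ultimately show ?thesis
    using T_series unique by blast
qed

end
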